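(* Let $\mathbf{k}$ be a field of characteristic $0$ and $\lambda\in\mathbf{k}$. Let $(V,\rho^L,\rho^R,K_V)$ be a representation over a modified Rota-Baxter Leibniz algebra $(\mathfrak{g},[\cdot,\cdot]_{\mathfrak{g}},K)$ of weight $\lambda$, and let $\psi:\mathfrak{g}\otimes\mathfrak{g}\to V$ and $\chi:\mathfrak{g}\to V$ be linear maps. On $\mathfrak{g}\oplus V$ define $$[x+u,y+v]_\psi=[x,y]_{\mathfrak{g}}+\rho^L(x)v+\rho^R(y)u+\psi(x,y),\qquad K_\chi(x+u)=K(x)+\chi(x)+K_V(u)$$ for $x,y\in\mathfrak{g}$, $u,v\in V$. Then $(\mathfrak{g}\oplus V,[\cdot,\cdot]_\psi,K_\chi)$ is a modified Rota-Baxter Leibniz algebra of weight $\lambda$ if and only if $(\psi,\chi)$ is a 2-cocycle of the modified Rota-Baxter Leibniz algebra $(\mathfrak{g},[\cdot,\cdot]_{\mathfrak{g}},K)$ with coefficients in $(V,\rho^L,\rho^R,K_V)$. In this case, the maps $V\to\mathfrak{g}\oplus V$, $v\mapsto 0+v$, and $\mathfrak{g}\oplus V\to\mathfrak{g}$, $x+v\mapsto x$, give an abelian extension $$0\to(V,0,K_V)\to(\mathfrak{g}\oplus V,[\cdot,\cdot]_\psi,K_\chi)\to(\mathfrak{g},[\cdot,\cdot]_{\mathfrak{g}},K)\to0,$$ and the canonical section $s:\mathfrak{g}\to\mathfrak{g}\oplus V$, $s(x)=x+0$, endows $V$ with the original representation, i.e. $[s(x),v]_\psi=\rho^L(x)v$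 and $[v,s(x)]_\psi=\rho^R(x)v$ for all $x\in\mathfrak{g}$, $v\in V$.
   Context: A (left) Leibniz algebra is a vector space with a bilinear bracket satisfying $[x,[y,z]]=[[x,y],z]+[y,[x,z]]$. A modified Rota-Baxter Leibniz algebra of weight $\lambda$ is a Leibniz algebra with a linear map $K$ satisfying $[K(x),K(y)]=K([K(x),y]+[x,K(y)])+\lambda[x,y]$. Morphisms are Leibniz algebra homomorphisms commuting with the operators. A representation of a Leibniz algebra $\mathfrak{g}$ is $(V,\rho^L,\rho^R)$ with $\rho^L,\rho^R:\mathfrak{g}\to\mathfrak{gl}(V)$ linear such that $\rho^L([x,y])=\rho^L(x)\rho^L(y)-\rho^L(y)\rho^L(x)$; $\rho^R([x,y])=\rho^L(x)\rho^R(y)-\rho^R(y)\rho^L(x)$; $\rho^R([x,y])=\rho^L(x)\rho^R(y)+\rho^R(y)\rho^R(x)$. A representation over $(\mathfrak{g},[\cdot,\cdot],K)$ of weight $\lambda$ is such a triple with a linear $K_V:V\to V$ such that for $\rho=\rho^L$ and for $\rho=\rho^R$, $\rho(K(x))K_V(v)=K_V(\rho(K(x))v+\rho(x)K_V(v))+\lambda\rho(x)v$. An abelian extension of $(\mathfrak{g},[\cdot,\cdot]_{\mathfrak{g}},K)$ by $(V,0,K_V)$ (zero bracket on $V$) is a short exact sequence of morphisms of modified Rota-Baxter Leibniz algebras $0\to(V,K_V)\to(\hat{\mathfrak{g}},\hat K)\to(\mathfrak{g},K)\to0$. A section is a linear right inverse of $\hat{\mathfrak{g}}\to\mathfrak{g}$.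 2-cocycles: put $[x,y]_K=[K(x),y]+[x,K(y)]$, $\rho^L_K(x)v=\rho^L(K(x))v-K_V(\rho^L(x)v)$, $\rho^R_K(x)v=\rho^R(K(x))v-K_V(\rho^R(x)v)$. For $f\in\mathrm{Hom}(\mathfrak{g}^{\otimes2},V)$, $$(\delta^2f)(x,y,z)=\rho^L(x)f(y,z)-\rho^L(y)f(x,z)-\rho^R(z)f(x,y)-f([x,y],z)-f(y,[x,z])+f(x,[y,z]),$$ $$\Phi^2(f)(x,y)=f(K(x),K(y))-K_V\big(f(K(x),y)+f(x,K(y))\big)-\lambda f(x,y);$$ for $g\in\mathrm{Hom}(\mathfrak{g},V)$, $(\partial^1g)(x,y)=\rho^L_K(x)g(y)+\rho^R_K(y)g(x)-g([x,y]_K)$. A pair $(f,g)\in\mathrm{Hom}(\mathfrak{g}^{\otimes2},V)\oplus\mathrm{Hom}(\mathfrak{g},V)$ is a 2-cocycle if $d^2(f,g)=(\delta^2f,-\partial^1g-\Phi^2f)=0$. *)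

theory Defs
  imports "HOL-Analysis.Product_Vector"
begin

text \<open>
  Vector spaces are in the sense of \<^locale>\<open>vector_space\<close>: the carrier is a whole type, the
  scalar multiplication is explicit. Linear maps out of a tensor square are rendered as bilinear
  maps out of the pair of factors.
\<close>

definition bilinear_map ::
  "('k::field \<Rightarrow> 'a::ab_group_add \<Rightarrow> 'a) \<Rightarrow> ('k \<Rightarrow> 'b::ab_group_add \<Rightarrow> 'b) \<Rightarrow>
   ('k \<Rightarrow> 'c::ab_group_add \<Rightarrow> 'c) \<Rightarrow> ('a \<Rightarrow> 'b \<Rightarrow> 'c) \<Rightarrow> bool"
  where "bilinear_map s1 s2 s3 f \<longleftrightarrow>
    (\<forall>y. Vector_Spaces.linear s1 s3 (\<lambda>x. f x y)) \<and>
    (\<forall>x. Vector_Spaces.linear s2 s3 (\<lambda>y. f x y))"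

locale leibniz_algebra = vector_space sg
  for sg :: "'k::field \<Rightarrow> 'g::ab_group_add \<Rightarrow> 'g" +
  fixes br :: "'g \<Rightarrow> 'g \<Rightarrow> 'g"
  assumes bilinear_br: "bilinear_map sg sg sg br"
    and leibniz: "br x (br y z) = br (br x y) z + br y (br x z)"

locale mrb_leibniz_algebra = leibniz_algebra sg br
  for lam :: "'k::field"
    and sg :: "'k \<Rightarrow> 'g::ab_group_add \<Rightarrow> 'g"
    and br :: "'g \<Rightarrow> 'g \<Rightarrow> 'g" +
  fixes K :: "'g \<Rightarrow> 'g"
  assumes linear_K: "Vector_Spaces.linear sg sg K"
    and modified_rota_baxter: "br (K x) (K y) = K (br (K x) y + br x (K y)) + sg lam (br x y)"

locale mrb_leibniz_morphism =
  dom: mrb_leibniz_algebra lam s1 br1 K1 +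
  cod: mrb_leibniz_algebra lam s2 br2 K2
  for lam :: "'k::field"
    and s1 :: "'k \<Rightarrow> 'a::ab_group_add \<Rightarrow> 'a" and br1 :: "'a \<Rightarrow> 'a \<Rightarrow> 'a" and K1 :: "'a \<Rightarrow> 'a"
    and s2 :: "'k \<Rightarrow> 'b::ab_group_add \<Rightarrow> 'b" and br2 :: "'b \<Rightarrow> 'b \<Rightarrow> 'b" and K2 :: "'b \<Rightarrow> 'b" +
  fixes h :: "'a \<Rightarrow> 'b"
  assumes linear_h: "Vector_Spaces.linear s1 s2 h"
    and h_br: "h (br1 x y) = br2 (h x) (h y)"
    and h_K: "h (K1 x) = K2 (h x)"

text \<open>
  Bilinearity of \<open>rhoL\<close> says that every \<open>rhoL x\<close> is a linear endomorphism and that \<open>rhoL\<close>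
  is linear as a map into these endomorphisms; likewise for \<open>rhoR\<close>.
\<close>

locale leibniz_representation =
  leibniz_algebra sg br + V: vector_space sV
  for sg :: "'k::field \<Rightarrow> 'g::ab_group_add \<Rightarrow> 'g"
    and br :: "'g \<Rightarrow> 'g \<Rightarrow> 'g"
    and sV :: "'k \<Rightarrow> 'v::ab_group_add \<Rightarrow> 'v" +
  fixes rhoL rhoR :: "'g \<Rightarrow> 'v \<Rightarrow> 'v"
  assumes bilinear_rhoL: "bilinear_map sg sV sV rhoL"
    and bilinear_rhoR: "bilinear_map sg sV sV rhoR"
    and rhoL_br: "rhoL (br x y) v = rhoL x (rhoL y v) - rhoL y (rhoL x v)"
    and rhoR_br: "rhoR (br x y) v = rhoL x (rhoR y v) - rhoR y (rhoL x v)"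
    and rhoR_br': "rhoR (br x y) v = rhoL x (rhoR y v) + rhoR y (rhoR x v)"

locale mrb_leibniz_representation =
  mrb_leibniz_algebra lam sg br K + leibniz_representation sg br sV rhoL rhoR
  for lam :: "'k::field"
    and sg :: "'k \<Rightarrow> 'g::ab_group_add \<Rightarrow> 'g"
    and br :: "'g \<Rightarrow> 'g \<Rightarrow> 'g"
    and K :: "'g \<Rightarrow> 'g"
    and sV :: "'k \<Rightarrow> 'v::ab_group_add \<Rightarrow> 'v"
    and rhoL rhoR :: "'g \<Rightarrow> 'v \<Rightarrow> 'v" +
  fixes KV :: "'v \<Rightarrow> 'v"
  assumes linear_KV: "Vector_Spaces.linear sV sV KV"
    and rhoL_KV: "rhoL (K x) (KV v) = KV (rhoL (K x) v + rhoL x (KV v)) + sV lam (rhoL x v)"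
    and rhoR_KV: "rhoR (K x) (KV v) = KV (rhoR (K x) v + rhoR x (KV v)) + sV lam (rhoR x v)"

text \<open>An extension of \<open>(sg, br, K)\<close> by \<open>V\<close> with zero bracket; \<open>E\<close> is the middle term.\<close>

locale abelian_extension =
  inc: mrb_leibniz_morphism lam sV "\<lambda>_ _. 0" KV sE brE KE i +
  proj: mrb_leibniz_morphism lam sE brE KE sg br K p
  for lam :: "'k::field"
    and sV :: "'k \<Rightarrow> 'v::ab_group_add \<Rightarrow> 'v" and KV :: "'v \<Rightarrow> 'v"
    and sE :: "'k \<Rightarrow> 'e::ab_group_add \<Rightarrow> 'e" and brE :: "'e \<Rightarrow> 'e \<Rightarrow> 'e" and KE :: "'e \<Rightarrow> 'e"
    and sg :: "'k \<Rightarrow> 'g::ab_group_add \<Rightarrow> 'g" and br :: "'g \<Rightarrow> 'g \<Rightarrow> 'g" and K :: "'g \<Rightarrow> 'g"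
    and i :: "'v \<Rightarrow> 'e" and p :: "'e \<Rightarrow> 'g" +
  assumes inj_i: "inj i"
    and exact: "range i = {e. p e = 0}"
    and surj_p: "surj p"

definition linear_section ::
  "('k::field \<Rightarrow> 'e::ab_group_add \<Rightarrow> 'e) \<Rightarrow> ('k \<Rightarrow> 'g::ab_group_add \<Rightarrow> 'g) \<Rightarrow>
   ('e \<Rightarrow> 'g) \<Rightarrow> ('g \<Rightarrow> 'e) \<Rightarrow> bool"
  where "linear_section sE sg p s \<longleftrightarrow> Vector_Spaces.linear sg sE s \<and> (\<forall>x. p (s x) = x)"

definition br_K :: "('g::ab_group_add \<Rightarrow> 'g \<Rightarrow> 'g) \<Rightarrow> ('g \<Rightarrow> 'g) \<Rightarrow> 'g \<Rightarrow> 'g \<Rightarrow> 'g"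
  where "br_K br K x y = br (K x) y + br x (K y)"

definition rho_K ::
  "('g \<Rightarrow> 'g) \<Rightarrow> ('v \<Rightarrow> 'v) \<Rightarrow> ('g \<Rightarrow> 'v \<Rightarrow> 'v) \<Rightarrow> 'g \<Rightarrow> 'v \<Rightarrow> 'v::ab_group_add"
  where "rho_K K KV rho x v = rho (K x) v - KV (rho x v)"

definition delta2 ::
  "('g \<Rightarrow> 'g \<Rightarrow> 'g) \<Rightarrow> ('g \<Rightarrow> 'v \<Rightarrow> 'v) \<Rightarrow> ('g \<Rightarrow> 'v \<Rightarrow> 'v) \<Rightarrow>
   ('g \<Rightarrow> 'g \<Rightarrow> 'v) \<Rightarrow> 'g \<Rightarrow> 'g \<Rightarrow> 'g \<Rightarrow> 'v::ab_group_add"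
  where "delta2 br rhoL rhoR f x y z =
    rhoL x (f y z) - rhoL y (f x z) - rhoR z (f x y)
    - f (br x y) z - f y (br x z) + f x (br y z)"

definition Phi2 ::
  "'k \<Rightarrow> ('g \<Rightarrow> 'g) \<Rightarrow> ('k \<Rightarrow> 'v \<Rightarrow> 'v) \<Rightarrow> ('v \<Rightarrow> 'v) \<Rightarrow>
   ('g \<Rightarrow> 'g \<Rightarrow> 'v) \<Rightarrow> 'g \<Rightarrow> 'g \<Rightarrow> 'v::ab_group_add"
  where "Phi2 lam K sV KV f x y =
    f (K x) (K y) - KV (f (K x) y + f x (K y)) - sV lam (f x y)"

definition partial1 ::
  "('g::ab_group_add \<Rightarrow> 'g \<Rightarrow> 'g) \<Rightarrow> ('g \<Rightarrow> 'g) \<Rightarrow> ('g \<Rightarrow> 'v \<Rightarrow> 'v) \<Rightarrow> ('g \<Rightarrow> 'v \<Rightarrow> 'v) \<Rightarrow>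
   ('v \<Rightarrow> 'v) \<Rightarrow> ('g \<Rightarrow> 'v) \<Rightarrow> 'g \<Rightarrow> 'g \<Rightarrow> 'v::ab_group_add"
  where "partial1 br K rhoL rhoR KV g x y =
    rho_K K KV rhoL x (g y) + rho_K K KV rhoR y (g x) - g (br_K br K x y)"

definition d2 ::
  "'k \<Rightarrow> ('g::ab_group_add \<Rightarrow> 'g \<Rightarrow> 'g) \<Rightarrow> ('g \<Rightarrow> 'g) \<Rightarrow>
   ('k \<Rightarrow> 'v \<Rightarrow> 'v) \<Rightarrow> ('g \<Rightarrow> 'v \<Rightarrow> 'v) \<Rightarrow> ('g \<Rightarrow> 'v \<Rightarrow> 'v) \<Rightarrow> ('v \<Rightarrow> 'v) \<Rightarrow>
   ('g \<Rightarrow> 'g \<Rightarrow> 'v) \<times> ('g \<Rightarrow> 'v) \<Rightarrow> ('g \<Rightarrow> 'g \<Rightarrow> 'g \<Rightarrow> 'v) \<times> ('g \<Rightarrow> 'g \<Rightarrow> 'v::ab_group_add)"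
  where "d2 lam br K sV rhoL rhoR KV = (\<lambda>(f, g).
    (delta2 br rhoL rhoR f,
     \<lambda>x y. - partial1 br K rhoL rhoR KV g x y - Phi2 lam K sV KV f x y))"

definition two_cocycle ::
  "'k::field \<Rightarrow> ('k \<Rightarrow> 'g::ab_group_add \<Rightarrow> 'g) \<Rightarrow> ('g \<Rightarrow> 'g \<Rightarrow> 'g) \<Rightarrow> ('g \<Rightarrow> 'g) \<Rightarrow>
   ('k \<Rightarrow> 'v::ab_group_add \<Rightarrow> 'v) \<Rightarrow> ('g \<Rightarrow> 'v \<Rightarrow> 'v) \<Rightarrow> ('g \<Rightarrow> 'v \<Rightarrow> 'v) \<Rightarrow> ('v \<Rightarrow> 'v) \<Rightarrow>
   ('g \<Rightarrow> 'g \<Rightarrow> 'v) \<times> ('g \<Rightarrow> 'v) \<Rightarrow> bool"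
  where "two_cocycle lam sg br K sV rhoL rhoR KV fg \<longleftrightarrow>
    bilinear_map sg sg sV (fst fg) \<and> Vector_Spaces.linear sg sV (snd fg) \<and>
    d2 lam br K sV rhoL rhoR KV fg = (\<lambda>_ _ _. 0, \<lambda>_ _. 0)"

text \<open>
  The direct sum of the underlying spaces is the product type; \<open>x + u\<close> is the pair \<open>(x, u)\<close>.
\<close>

definition br_psi ::
  "('g \<Rightarrow> 'g \<Rightarrow> 'g) \<Rightarrow> ('g \<Rightarrow> 'v \<Rightarrow> 'v) \<Rightarrow> ('g \<Rightarrow> 'v \<Rightarrow> 'v) \<Rightarrow> ('g \<Rightarrow> 'g \<Rightarrow> 'v) \<Rightarrow>
   'g \<times> 'v \<Rightarrow> 'g \<times> 'v \<Rightarrow> 'g \<times> 'v::ab_group_add"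
  where "br_psi br rhoL rhoR psi = (\<lambda>(x, u) (y, v).
    (br x y, rhoL x v + rhoR y u + psi x y))"

definition K_chi ::
  "('g \<Rightarrow> 'g) \<Rightarrow> ('v \<Rightarrow> 'v) \<Rightarrow> ('g \<Rightarrow> 'v) \<Rightarrow> 'g \<times> 'v \<Rightarrow> 'g \<times> 'v::ab_group_add"
  where "K_chi K KV chi = (\<lambda>(x, u). (K x, chi x + KV u))"

end

theory Submission
  imports Defs
begin

text \<open>
  The \<open>g\<close>-component of each axiom on \<open>g \<oplus> V\<close> is the same axiom on \<open>g\<close>. In the
  \<open>V\<close>-component the terms containing a vector of \<open>V\<close> cancel by the representation axioms, and
  what remains is \<open>\<delta>\<^sup>2\<psi> = 0\<close> for the Leibniz identity and \<open>\<partial>\<^sup>1\<chi> + \<Phi>\<^sup>2\<psi> = 0\<close> for the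
  modified Rota-Baxter identity.
\<close>

lemma bilinear_map_iff:
  assumes "vector_space s1" "vector_space s2" "vector_space s3"
  shows "bilinear_map s1 s2 s3 f \<longleftrightarrow>
    (\<forall>x x' y. f (x + x') y = f x y + f x' y) \<and> (\<forall>c x y. f (s1 c x) y = s3 c (f x y)) \<and>
    (\<forall>x y y'. f x (y + y') = f x y + f x y') \<and> (\<forall>c x y. f x (s2 c y) = s3 c (f x y))"
  using assms by (auto simp: bilinear_map_def Vector_Spaces.linear_iff)

lemma linear_map_zero: "Vector_Spaces.linear s1 s2 f \<Longrightarrow> f 0 = 0"
  by (metis Vector_Spaces.linear_iff add_cancel_right_right)

lemma bilinear_map_zero:
  assumes "bilinear_map s1 s2 s3 f"
  shows "f 0 y = 0" "f x 0 = 0"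
  using assms linear_map_zero unfolding bilinear_map_def by fast+

context mrb_leibniz_representation
begin

sublocale E: vector_space_prod sg sV ..

lemmas br_simps =
  bilinear_br[unfolded bilinear_map_iff[OF
      vector_space_axioms vector_space_axioms vector_space_axioms]]
lemmas rhoL_simps =
  bilinear_rhoL[unfolded bilinear_map_iff[OF
      vector_space_axioms V.vector_space_axioms V.vector_space_axioms]]
lemmas rhoR_simps =
  bilinear_rhoR[unfolded bilinear_map_iff[OF
      vector_space_axioms V.vector_space_axioms V.vector_space_axioms]]
lemmas K_simps = linear_K[unfolded Vector_Spaces.linear_iff]
lemmas KV_simps = linear_KV[unfolded Vector_Spaces.linear_iff]

lemma zeros:
  "br 0 x = 0" "br x 0 = 0" "rhoL 0 v = 0" "rhoL x 0 = 0" "rhoR 0 v = 0" "rhoR x 0 = 0"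
  "K 0 = 0" "KV 0 = 0"
  using bilinear_map_zero[OF bilinear_br] bilinear_map_zero[OF bilinear_rhoL]
    bilinear_map_zero[OF bilinear_rhoR] linear_map_zero[OF linear_K] linear_map_zero[OF linear_KV]
  by blast+

end

text \<open>Only the linear data are fixed here, without the cocycle condition: they already make
  \<open>brE\<close> bilinear and \<open>KE\<close> linear, so both directions of the equivalence
  concern the two identities alone.\<close>

locale leibniz_extension_data =
  mrb_leibniz_representation lam sg br K sV rhoL rhoR KV
  for lam :: "'k::field"
    and sg :: "'k \<Rightarrow> 'g::ab_group_add \<Rightarrow> 'g"
    and br :: "'g \<Rightarrow> 'g \<Rightarrow> 'g"
    and K :: "'g \<Rightarrow> 'g"
    and sV :: "'k \<Rightarrow> 'v::ab_group_add \<Rightarrow> 'v"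
    and rhoL rhoR :: "'g \<Rightarrow> 'v \<Rightarrow> 'v"
    and KV :: "'v \<Rightarrow> 'v" +
  fixes psi :: "'g \<Rightarrow> 'g \<Rightarrow> 'v"
    and chi :: "'g \<Rightarrow> 'v"
  assumes bilinear_psi: "bilinear_map sg sg sV psi"
    and linear_chi: "Vector_Spaces.linear sg sV chi"
begin

lemmas psi_simps =
  bilinear_psi[unfolded bilinear_map_iff[OF
      vector_space_axioms vector_space_axioms V.vector_space_axioms]]
lemmas chi_simps = linear_chi[unfolded Vector_Spaces.linear_iff]

lemmas linearity = br_simps rhoL_simps rhoR_simps K_simps KV_simps psi_simps chi_simps

abbreviation "sE \<equiv> module_prod.scale sg sV"
abbreviation "brE \<equiv> br_psi br rhoL rhoR psi"
abbreviation "KE \<equiv> K_chi K KV chi"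

lemma psi_chi_zeros: "psi 0 x = 0" "psi x 0 = 0" "chi 0 = 0"
  using bilinear_map_zero[OF bilinear_psi] linear_map_zero[OF linear_chi] by blast+

lemma bilinear_brE: "bilinear_map sE sE sE brE"
  by (auto simp: bilinear_map_iff E.p.vector_space_axioms br_psi_def E.scale_prod linearity
      V.scale_right_distrib algebra_simps)

lemma linear_KE: "Vector_Spaces.linear sE sE KE"
  by (auto simp: Vector_Spaces.linear_iff E.p.vector_space_axioms K_chi_def E.scale_prod linearity
      V.scale_right_distrib algebra_simps)

text \<open>The terms in \<open>w\<close> cancel by \<open>rhoL_br\<close>, those in
  \<open>v\<close> by \<open>rhoR_br\<close> at \<open>x\<close>, \<open>z\<close>, and those in
  \<open>u\<close> by \<open>rhoR_br'\<close> at \<open>y\<close>, \<open>z\<close>; only terms in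
  \<open>psi\<close> survive.\<close>

lemma leibniz_brE_diff:
  "brE (x, u) (brE (y, v) (z, w)) - brE (brE (x, u) (y, v)) (z, w) - brE (y, v) (brE (x, u) (z, w))
    = (0, delta2 br rhoL rhoR psi x y z)"
  \<comment> \<open>Fixed instances are essential: \<open>leibniz\<close> as a general rewrite rule
    would loop, and \<open>rhoR_br\<close> and \<open>rhoR_br'\<close> share their left-hand
    side.\<close>
  by (simp add: br_psi_def delta2_def linearity leibniz[of x y z] rhoL_br rhoR_br'[of y z]
      rhoR_br[of x z] algebra_simps)

text \<open>The terms in \<open>v\<close> cancel by \<open>rhoL_KV\<close> and those in
  \<open>u\<close> by \<open>rhoR_KV\<close>. The terms in \<open>chi\<close> collect to
  \<open>partial1\<close>, those in \<open>psi\<close> to \<open>Phi2\<close>.\<close>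

lemma modified_rota_baxter_diff:
  "brE (KE (x, u)) (KE (y, v)) - KE (brE (KE (x, u)) (y, v) + brE (x, u) (KE (y, v)))
      - sE lam (brE (x, u) (y, v))
    = (0, partial1 br K rhoL rhoR KV chi x y + Phi2 lam K sV KV psi x y)"
  by (simp add: br_psi_def K_chi_def E.scale_prod partial1_def Phi2_def rho_K_def br_K_def linearity
      modified_rota_baxter rhoL_KV rhoR_KV V.scale_right_distrib algebra_simps)

lemma mrb_leibniz_algebra_iff_two_cocycle:
  "mrb_leibniz_algebra lam sE brE KE \<longleftrightarrow> two_cocycle lam sg br K sV rhoL rhoR KV (psi, chi)"
proof -
  \<comment> \<open>Both identities are put as vanishing differences, so that the two computed
    defects can be substituted.\<close>
  have "mrb_leibniz_algebra lam sE brE KE \<longleftrightarrow>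
      (\<forall>a b c. brE a (brE b c) - brE (brE a b) c - brE b (brE a c) = 0) \<and>
      (\<forall>a b. brE (KE a) (KE b) - KE (brE (KE a) b + brE a (KE b)) - sE lam (brE a b) = 0)"
    by (simp add: mrb_leibniz_algebra_def mrb_leibniz_algebra_axioms_def leibniz_algebra_def
        leibniz_algebra_axioms_def E.p.vector_space_axioms bilinear_brE linear_KE
        diff_diff_eq)
  also have "\<dots> \<longleftrightarrow> (\<forall>x y z. delta2 br rhoL rhoR psi x y z = 0) \<and>
      (\<forall>x y. partial1 br K rhoL rhoR KV chi x y + Phi2 lam K sV KV psi x y = 0)"
    by (simp add: split_paired_all leibniz_brE_diff modified_rota_baxter_diff zero_prod_def)
  also have "\<dots> \<longleftrightarrow> two_cocycle lam sg br K sV rhoL rhoR KV (psi, chi)"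
    \<comment> \<open>The second component of \<open>d2\<close> is the negative of the Rota-Baxter
      defect, so the two vanish together.\<close>
    by (simp add: two_cocycle_def d2_def bilinear_psi linear_chi fun_eq_iff
        neg_eq_iff_add_eq_0)
  finally show ?thesis .
qed

lemma mrb_leibniz_algebra_zero_bracket: "mrb_leibniz_algebra lam sV (\<lambda>_ _. 0) KV"
  by unfold_locales
    (auto simp: bilinear_map_iff V.vector_space_axioms KV_simps zeros)

lemma abelian_extension_of_two_cocycle:
  assumes "two_cocycle lam sg br K sV rhoL rhoR KV (psi, chi)"
  shows "abelian_extension lam sV KV sE brE KE sg br K (\<lambda>v. (0, v)) fst"
proof -
  \<comment> \<open>The cocycle condition enters only here, to make the middle term an algebra. The
    inclusion is a morphism because \<open>rhoL 0\<close>, \<open>rhoR 0\<close>,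
    \<open>psi 0 0\<close> and \<open>chi 0\<close> vanish.\<close>
  interpret A: mrb_leibniz_algebra lam sE brE KE
    using assms by (simp add: mrb_leibniz_algebra_iff_two_cocycle)
  interpret I: mrb_leibniz_algebra lam sV "\<lambda>_ _. 0" KV
    by (rule mrb_leibniz_algebra_zero_bracket)
  show ?thesis
    by unfold_locales
      (auto simp: Vector_Spaces.linear_iff vector_space_axioms V.vector_space_axioms
        E.p.vector_space_axioms E.scale_prod br_psi_def K_chi_def zeros psi_chi_zeros surj_def inj_def zero_prod_def)
qed

lemma linear_section_E: "linear_section sE sg fst (\<lambda>x. (x, 0))"
  by (simp add: linear_section_def Vector_Spaces.linear_iff vector_space_axioms
      E.p.vector_space_axioms E.scale_prod)

text \<open>A vector of \<open>V\<close> lies over \<open>0\<close>, where \<open>psi\<close>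
  vanishes by bilinearity, so mixed brackets do not see the twist by \<open>psi\<close>.\<close>

lemma brE_section: "brE (x, 0) (0, v) = (0, rhoL x v)" "brE (0, v) (x, 0) = (0, rhoR x v)"
  by (simp_all add: br_psi_def zeros psi_chi_zeros)

end

theorem proposition5p7:
  fixes lam :: "'k::field_char_0"
    and sg :: "'k \<Rightarrow> 'g::ab_group_add \<Rightarrow> 'g"
    and br :: "'g \<Rightarrow> 'g \<Rightarrow> 'g"
    and K :: "'g \<Rightarrow> 'g"
    and sV :: "'k \<Rightarrow> 'v::ab_group_add \<Rightarrow> 'v"
    and rhoL rhoR :: "'g \<Rightarrow> 'v \<Rightarrow> 'v"
    and KV :: "'v \<Rightarrow> 'v"
    and psi :: "'g \<Rightarrow> 'g \<Rightarrow> 'v"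
    and chi :: "'g \<Rightarrow> 'v"
  assumes "mrb_leibniz_algebra lam sg br K"
    and "mrb_leibniz_representation lam sg br K sV rhoL rhoR KV"
    and "bilinear_map sg sg sV psi"
    and "Vector_Spaces.linear sg sV chi"
  shows
    "(mrb_leibniz_algebra lam (module_prod.scale sg sV)
        (br_psi br rhoL rhoR psi) (K_chi K KV chi)
      \<longleftrightarrow> two_cocycle lam sg br K sV rhoL rhoR KV (psi, chi)) \<and>
     (two_cocycle lam sg br K sV rhoL rhoR KV (psi, chi) \<longrightarrow>
        abelian_extension lam sV KV
          (module_prod.scale sg sV) (br_psi br rhoL rhoR psi) (K_chi K KV chi)
          sg br K (\<lambda>v. (0, v)) fst \<and>
        linear_section (module_prod.scale sg sV) sg fst (\<lambda>x. (x, 0)) \<and>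
        (\<forall>x v. br_psi br rhoL rhoR psi (x, 0) (0, v) = (0, rhoL x v) \<and>
               br_psi br rhoL rhoR psi (0, v) (x, 0) = (0, rhoR x v)))"
proof -
  interpret leibniz_extension_data lam sg br K sV rhoL rhoR KV psi chi
    using assms by (simp add: leibniz_extension_data_def leibniz_extension_data_axioms_def)
  show ?thesis
    using mrb_leibniz_algebra_iff_two_cocycle abelian_extension_of_two_cocycle
      linear_section_E brE_section
    by blast
qed

end
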